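(* Let $\nu>0$, $\tau>0$, let $c,k$ be as in the context, and let $\sigma$ satisfy $\nu c_0\sigma\ge 0.5$. Define on $H$ $$C=\sum_{\alpha=1}^2C_\alpha,\qquad C_\alpha=A_\alpha^*\bigl(k^{-1}E+\sigma\tau^2A_\alpha A_\alpha^*\bigr)^{-1}A_\alpha,\qquad R=\nu cE-\frac{\tau^2}{4}C .$$ Let $u^0,\dots,u^N\in H$ satisfy the additive scheme $$\nu c\,\frac{u^{n+1}-2u^n+u^{n-1}}{\tau^2}+c\,\frac{u^{n+1}-u^{n-1}}{2\tau}+Cu^n=\varphi^n,\qquad n=1,\dots,N-1,$$ with $\varphi^n=f^n+\nu\,\dfrac{f^{n+1}-f^{n-1}}{2\tau}$ for given $f^0,\dots,f^N\in H$, and initial data $u^0=v_0$, $(u^1-u^0)/\tau=w_0$ with given $v_0,w_0\in H$. For $n=1,\dots,N$ put $$S^n=\Bigl(R\,\frac{u^n-u^{n-1}}{\tau},\frac{u^n-u^{n-1}}{\tau}\Bigr)+\Bigl(C\,\frac{u^n+u^{n-1}}{2},\frac{u^n+u^{n-1}}{2}\Bigr).$$ Then the scheme is unconditionally stable: with no restriction on $\tau,h_1,h_2$, one has $R>0$ and $S^n$ is the square of a norm of the pair $(u^n,u^{n-1})$ (a positive definite quadratic form on $H\times H$), and $$S^{n+1}\le S^n+\frac{\tau}{2}\,(c^{-1}\varphi^n,\varphi^n),\qquad n=1,\dots,N-1.$$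
   Context: Let $\Omega=(0,l_1)\times(0,l_2)$, let $c,k$ be real functions on $\Omega$ with $c(\mathbf{x})\ge c_0>0$ and $k_0\le k(\mathbf{x})\le k_1$, $k_0>0$, and let $\nu>0$ be a constant. Let $h_\alpha=l_\alpha/N_\alpha$ ($N_\alpha\ge2$ integers, $\alpha=1,2$). Grids: $\omega$ is the set of points $(i_1h_1,i_2h_2)$ with $1\le i_\alpha\le N_\alpha-1$; $\omega_1$ is the set of points $((i_1+\tfrac12)h_1,i_2h_2)$ with $0\le i_1\le N_1-1$, $1\le i_2\le N_2-1$; $\omega_2$ is the set of points $(i_1h_1,(i_2+\tfrac12)h_2)$ with $1\le i_1\le N_1-1$, $0\le i_2\le N_2-1$. $H$ is the space of real functions on the points $(i_1h_1,i_2h_2)$, $0\le i_\alpha\le N_\alpha$, vanishing at the points on $\partial\Omega$, with scalar product $(y,w)=\sum_{\mathbf{x}\in\omega}y(\mathbf{x})w(\mathbf{x})h_1h_2$. $H_\alpha$ is the space of real functions on $\omega_\alpha$ with $(y,w)_\alpha=\sum_{\mathbf{x}\in\omega_\alpha}y(\mathbf{x})w(\mathbf{x})h_1h_2$. The operators $A_\alpha:H\to H_\alpha$ are $(A_1y)(\mathbf{x})=\frac{y(x_1+0.5h_1,x_2)-y(x_1-0.5h_1,x_2)}{h_1}$, $\mathbf{x}\in\omega_1$, and $(A_2y)(\mathbf{x})=\frac{y(x_1,x_2+0.5h_2)-y(x_1,x_2-0.5h_2)}{h_2}$, $\mathbf{x}\in\omega_2$; $A_\alpha^*:H_\alpha\to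 H$ are their adjoints. Here $c$ and $k$ also denote the multiplication operators by the values of $c$ at points of $\omega$ and of $k$ at points of $\omega_\alpha$ (so $k^{-1}E$ acts on $H_\alpha$); $E$ is the identity; $R>0$ means $R$ is positive definite. Time grid: $t_n=n\tau$, $n=0,\dots,N$, $N\tau=T$, $N\ge 2$; superscript $n$ denotes the value at $t_n$. *)

theory Defs
  imports Complex_Main "HOL-Library.Function_Algebras" "HOL-Library.Product_Plus"
begin

type_synonym gridfun = "real \<times> real \<Rightarrow> real"

definition omega :: "real \<Rightarrow> real \<Rightarrow> nat \<Rightarrow> nat \<Rightarrow> (real \<times> real) set" where
  "omega h1 h2 N1 N2 =
     {(real i1 * h1, real i2 * h2) | i1 i2. 1 \<le> i1 \<and> i1 \<le> N1 - 1 \<and> 1 \<le> i2 \<and> i2 \<le> N2 - 1}"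

definition omega1 :: "real \<Rightarrow> real \<Rightarrow> nat \<Rightarrow> nat \<Rightarrow> (real \<times> real) set" where
  "omega1 h1 h2 N1 N2 =
     {((real i1 + 1/2) * h1, real i2 * h2) | i1 i2. i1 \<le> N1 - 1 \<and> 1 \<le> i2 \<and> i2 \<le> N2 - 1}"

definition omega2 :: "real \<Rightarrow> real \<Rightarrow> nat \<Rightarrow> nat \<Rightarrow> (real \<times> real) set" where
  "omega2 h1 h2 N1 N2 =
     {(real i1 * h1, (real i2 + 1/2) * h2) | i1 i2. 1 \<le> i1 \<and> i1 \<le> N1 - 1 \<and> i2 \<le> N2 - 1}"

text \<open>
  A real function on a finite grid \<open>G\<close> is encoded as a function on the plane that is extended
  by zero outside \<open>G\<close>.  In particular the functions on the closed grid that vanish at the nodes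
  on the boundary of the rectangle are exactly the elements of \<open>grid_space (omega h1 h2 N1 N2)\<close>.
\<close>

definition grid_space :: "(real \<times> real) set \<Rightarrow> gridfun set" where
  "grid_space G = {y. \<forall>x. x \<notin> G \<longrightarrow> y x = 0}"

definition grid_inner :: "(real \<times> real) set \<Rightarrow> real \<Rightarrow> real \<Rightarrow> gridfun \<Rightarrow> gridfun \<Rightarrow> real" where
  "grid_inner G h1 h2 y w = (\<Sum>x\<in>G. y x * w x * h1 * h2)"

definition A1 :: "real \<Rightarrow> real \<Rightarrow> nat \<Rightarrow> nat \<Rightarrow> gridfun \<Rightarrow> gridfun" where
  "A1 h1 h2 N1 N2 y = (\<lambda>(x1, x2). if (x1, x2) \<in> omega1 h1 h2 N1 N2
     then (y (x1 + h1/2, x2) - y (x1 - h1/2, x2)) / h1 else 0)"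

definition A2 :: "real \<Rightarrow> real \<Rightarrow> nat \<Rightarrow> nat \<Rightarrow> gridfun \<Rightarrow> gridfun" where
  "A2 h1 h2 N1 N2 y = (\<lambda>(x1, x2). if (x1, x2) \<in> omega2 h1 h2 N1 N2
     then (y (x1, x2 + h2/2) - y (x1, x2 - h2/2)) / h2 else 0)"

text \<open>
  The adjoint of \<open>A : grid_space G \<rightarrow> grid_space G'\<close>; existence and uniqueness are
  \<open>adjoint_op_mem\<close>, \<open>adjoint_op_inner\<close> and \<open>adjoint_op_eqI\<close> below.
\<close>

definition adjoint_op ::
  "(real \<times> real) set \<Rightarrow> (real \<times> real) set \<Rightarrow> real \<Rightarrow> real \<Rightarrow> (gridfun \<Rightarrow> gridfun) \<Rightarrow> gridfun \<Rightarrow> gridfun"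
where
  "adjoint_op G G' h1 h2 A w =
     (THE v. v \<in> grid_space G \<and>
        (\<forall>y\<in>grid_space G. grid_inner G' h1 h2 (A y) w = grid_inner G h1 h2 y v))"

definition inner_op ::
  "(real \<times> real) set \<Rightarrow> (real \<times> real) set \<Rightarrow> real \<Rightarrow> real \<Rightarrow> (gridfun \<Rightarrow> gridfun) \<Rightarrow> gridfun
     \<Rightarrow> real \<Rightarrow> real \<Rightarrow> gridfun \<Rightarrow> gridfun"
where
  "inner_op G G' h1 h2 A k \<sigma> \<tau> w =
     (\<lambda>x. inverse (k x) * w x + \<sigma> * \<tau>\<^sup>2 * A (adjoint_op G G' h1 h2 A w) x)"

text \<open>
  The inverse is the one on \<open>grid_space G'\<close>; \<open>inner_op\<close> is a bijection of that space whenever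
  \<open>A\<close> is linear, \<open>k > 0\<close> on \<open>G'\<close> and \<open>\<sigma> \<ge> 0\<close>, see \<open>bij_inner_op\<close> below.
\<close>

definition Cpart ::
  "(real \<times> real) set \<Rightarrow> (real \<times> real) set \<Rightarrow> real \<Rightarrow> real \<Rightarrow> (gridfun \<Rightarrow> gridfun) \<Rightarrow> gridfun
     \<Rightarrow> real \<Rightarrow> real \<Rightarrow> gridfun \<Rightarrow> gridfun"
where
  "Cpart G G' h1 h2 A k \<sigma> \<tau> y =
     adjoint_op G G' h1 h2 A
       (inv_into (grid_space G') (inner_op G G' h1 h2 A k \<sigma> \<tau>) (A y))"

definition Cop ::
  "real \<Rightarrow> real \<Rightarrow> nat \<Rightarrow> nat \<Rightarrow> gridfun \<Rightarrow> real \<Rightarrow> real \<Rightarrow> gridfun \<Rightarrow> gridfun"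
where
  "Cop h1 h2 N1 N2 k \<sigma> \<tau> y = (\<lambda>x.
     Cpart (omega h1 h2 N1 N2) (omega1 h1 h2 N1 N2) h1 h2 (A1 h1 h2 N1 N2) k \<sigma> \<tau> y x +
     Cpart (omega h1 h2 N1 N2) (omega2 h1 h2 N1 N2) h1 h2 (A2 h1 h2 N1 N2) k \<sigma> \<tau> y x)"

definition Rop ::
  "real \<Rightarrow> real \<Rightarrow> nat \<Rightarrow> nat \<Rightarrow> gridfun \<Rightarrow> gridfun \<Rightarrow> real \<Rightarrow> real \<Rightarrow> real \<Rightarrow> gridfun \<Rightarrow> gridfun"
where
  "Rop h1 h2 N1 N2 c k \<nu> \<sigma> \<tau> y =
     (\<lambda>x. \<nu> * c x * y x - \<tau>\<^sup>2 / 4 * Cop h1 h2 N1 N2 k \<sigma> \<tau> y x)"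

text \<open>
  The following notions are relative to a carrier \<open>V\<close> that is meant to be a linear subspace of the
  ambient type; \<open>s\<close> is the scalar multiplication.
\<close>

definition scale_fun :: "real \<Rightarrow> gridfun \<Rightarrow> gridfun" where
  "scale_fun a y = (\<lambda>x. a * y x)"

definition scale_pair :: "real \<Rightarrow> gridfun \<times> gridfun \<Rightarrow> gridfun \<times> gridfun" where
  "scale_pair a z = (scale_fun a (fst z), scale_fun a (snd z))"

definition symmetric_bilinear_on ::
  "'v::ab_group_add set \<Rightarrow> (real \<Rightarrow> 'v \<Rightarrow> 'v) \<Rightarrow> ('v \<Rightarrow> 'v \<Rightarrow> real) \<Rightarrow> bool" where
  "symmetric_bilinear_on V s B \<longleftrightarrow>
     (\<forall>x\<in>V. \<forall>y\<in>V. B x y = B y x) \<and>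
     (\<forall>x\<in>V. \<forall>y\<in>V. \<forall>z\<in>V. B (x + y) z = B x z + B y z) \<and>
     (\<forall>a. \<forall>x\<in>V. \<forall>z\<in>V. B (s a x) z = a * B x z)"

definition pos_def_quadratic_form_on ::
  "'v::ab_group_add set \<Rightarrow> (real \<Rightarrow> 'v \<Rightarrow> 'v) \<Rightarrow> ('v \<Rightarrow> real) \<Rightarrow> bool" where
  "pos_def_quadratic_form_on V s q \<longleftrightarrow>
     (\<exists>B. symmetric_bilinear_on V s B \<and> (\<forall>x\<in>V. q x = B x x)) \<and>
     (\<forall>x\<in>V. x \<noteq> 0 \<longrightarrow> q x > 0)"

definition is_norm_on ::
  "'v::ab_group_add set \<Rightarrow> (real \<Rightarrow> 'v \<Rightarrow> 'v) \<Rightarrow> ('v \<Rightarrow> real) \<Rightarrow> bool" where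
  "is_norm_on V s p \<longleftrightarrow>
     (\<forall>x\<in>V. 0 \<le> p x \<and> (p x = 0 \<longleftrightarrow> x = 0)) \<and>
     (\<forall>a. \<forall>x\<in>V. p (s a x) = \<bar>a\<bar> * p x) \<and>
     (\<forall>x\<in>V. \<forall>y\<in>V. p (x + y) \<le> p x + p y)"

text \<open>
  As usual for operators in a real Hilbert space, positive definiteness comprises self-adjointness.
\<close>

definition pos_def_operator_on ::
  "'v::ab_group_add set \<Rightarrow> (real \<Rightarrow> 'v \<Rightarrow> 'v) \<Rightarrow> ('v \<Rightarrow> 'v \<Rightarrow> real) \<Rightarrow> ('v \<Rightarrow> 'v) \<Rightarrow> bool" where
  "pos_def_operator_on V s ip R \<longleftrightarrow>
     (\<forall>x\<in>V. R x \<in> V) \<and>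
     (\<forall>x\<in>V. \<forall>y\<in>V. R (x + y) = R x + R y) \<and>
     (\<forall>a. \<forall>x\<in>V. R (s a x) = s a (R x)) \<and>
     (\<forall>x\<in>V. \<forall>y\<in>V. ip (R x) y = ip x (R y)) \<and>
     (\<forall>x\<in>V. x \<noteq> 0 \<longrightarrow> ip (R x) x > 0)"

definition energy ::
  "(gridfun \<Rightarrow> gridfun \<Rightarrow> real) \<Rightarrow> (gridfun \<Rightarrow> gridfun) \<Rightarrow> (gridfun \<Rightarrow> gridfun) \<Rightarrow> real
     \<Rightarrow> gridfun \<times> gridfun \<Rightarrow> real" where
  "energy ip R C \<tau> = (\<lambda>(y, v).
     ip (R (\<lambda>x. (y x - v x) / \<tau>)) (\<lambda>x. (y x - v x) / \<tau>) +
     ip (C (\<lambda>x. (y x + v x) / 2)) (\<lambda>x. (y x + v x) / 2))"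


subsection \<open>Well-posedness of the adjoints and inverses\<close>

lemma finite_omega [simp]:
  "finite (omega h1 h2 N1 N2)" "finite (omega1 h1 h2 N1 N2)" "finite (omega2 h1 h2 N1 N2)"
proof -
  have "omega h1 h2 N1 N2 \<subseteq> (\<lambda>(i, j). (real i * h1, real j * h2)) ` ({..N1} \<times> {..N2})"
    by (force simp: omega_def)
  then show "finite (omega h1 h2 N1 N2)" by (rule finite_subset) simp
  have "omega1 h1 h2 N1 N2 \<subseteq> (\<lambda>(i, j). ((real i + 1/2) * h1, real j * h2)) ` ({..N1} \<times> {..N2})"
    by (force simp: omega1_def)
  then show "finite (omega1 h1 h2 N1 N2)" by (rule finite_subset) simp
  have "omega2 h1 h2 N1 N2 \<subseteq> (\<lambda>(i, j). (real i * h1, (real j + 1/2) * h2)) ` ({..N1} \<times> {..N2})"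
    by (force simp: omega2_def)
  then show "finite (omega2 h1 h2 N1 N2)" by (rule finite_subset) simp
qed

interpretation gf: vector_space scale_fun
  by standard (auto simp: scale_fun_def fun_eq_iff algebra_simps)

lemma sum_fun_apply: "sum (g :: 'i \<Rightarrow> gridfun) S x = (\<Sum>i\<in>S. g i x)"
  by (induction S rule: infinite_finite_induct) auto

definition gdelta :: "real \<times> real \<Rightarrow> gridfun" where
  "gdelta z = (\<lambda>x. if x = z then 1 else 0)"

lemma grid_space_outside: "y \<in> grid_space G \<Longrightarrow> z \<notin> G \<Longrightarrow> y z = 0"
  unfolding grid_space_def by blast

lemma gdelta_expand:
  assumes "finite G" "y \<in> grid_space G"
  shows "y = (\<Sum>z\<in>G. scale_fun (y z) (gdelta z))"
proof
  fix x
  have "(\<Sum>z\<in>G. scale_fun (y z) (gdelta z)) x = (\<Sum>z\<in>G. if x = z then y z else 0)"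
    by (simp add: sum_fun_apply scale_fun_def gdelta_def if_distrib cong: if_cong)
  also have "\<dots> = y x" using assms by (cases x; cases "x \<in> G") (simp_all add: grid_space_def)
  finally show "y x = (\<Sum>z\<in>G. scale_fun (y z) (gdelta z)) x" by simp
qed

lemma gdelta_mem: "z \<in> G \<Longrightarrow> gdelta z \<in> grid_space G"
  by (auto simp: gdelta_def grid_space_def)

lemma grid_inner_delta:
  assumes "finite G" "z \<in> G"
  shows "grid_inner G h1 h2 (gdelta z) v = v z * h1 * h2"
proof -
  have "grid_inner G h1 h2 (gdelta z) v = (\<Sum>x\<in>G. if x = z then v z * h1 * h2 else 0)"
    unfolding grid_inner_def gdelta_def by (rule sum.cong) auto
  then show ?thesis using assms by simp
qed

lemma grid_inner_linear:
  "grid_inner G h1 h2 (x + y) w = grid_inner G h1 h2 x w + grid_inner G h1 h2 y w"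
  "grid_inner G h1 h2 w (x + y) = grid_inner G h1 h2 w x + grid_inner G h1 h2 w y"
  "grid_inner G h1 h2 (scale_fun a x) w = a * grid_inner G h1 h2 x w"
  "grid_inner G h1 h2 w (scale_fun a x) = a * grid_inner G h1 h2 w x"
  by (simp_all add: grid_inner_def scale_fun_def algebra_simps sum.distrib sum_distrib_left)

lemma linear_A1: "Vector_Spaces.linear scale_fun scale_fun (A1 h1 h2 N1 N2)"
  and linear_A2: "Vector_Spaces.linear scale_fun scale_fun (A2 h1 h2 N1 N2)"
  by (unfold_locales;
      auto simp: A1_def A2_def scale_fun_def fun_eq_iff algebra_simps add_divide_distrib diff_divide_distrib)+

lemma A1_mem: "A1 h1 h2 N1 N2 y \<in> grid_space (omega1 h1 h2 N1 N2)"
  and A2_mem: "A2 h1 h2 N1 N2 y \<in> grid_space (omega2 h1 h2 N1 N2)"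
  by (auto simp: A1_def A2_def grid_space_def)

context
  fixes G G' :: "(real \<times> real) set" and h1 h2 :: real and A :: "gridfun \<Rightarrow> gridfun"
  assumes fin: "finite G" "finite G'" and h: "h1 > 0" "h2 > 0"
    and lin: "Vector_Spaces.linear scale_fun scale_fun A"
    and into: "\<And>y. A y \<in> grid_space G'"
begin

lemma adjoint_op_unique:
  "\<exists>!v. v \<in> grid_space G \<and>
     (\<forall>y\<in>grid_space G. grid_inner G' h1 h2 (A y) w = grid_inner G h1 h2 y v)"
proof (rule ex1I)
  interpret A: Vector_Spaces.linear scale_fun scale_fun A by (rule lin)
  define v where "v = (\<lambda>z. if z \<in> G then grid_inner G' h1 h2 (A (gdelta z)) w / (h1 * h2) else 0)"
  have sumL: "grid_inner G'' h1 h2 (sum g S) u = (\<Sum>i\<in>S. grid_inner G'' h1 h2 (g i) u)"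
    for G'' u and g :: "real \<times> real \<Rightarrow> gridfun" and S
    unfolding grid_inner_def sum_fun_apply sum_distrib_right by (rule sum.swap)
  have "grid_inner G' h1 h2 (A y) w = grid_inner G h1 h2 y v" if y: "y \<in> grid_space G" for y
  proof -
    have "grid_inner G' h1 h2 (A y) w
        = grid_inner G' h1 h2 (A (\<Sum>z\<in>G. scale_fun (y z) (gdelta z))) w"
      using gdelta_expand[OF fin(1) y] by simp
    also have "\<dots> = (\<Sum>z\<in>G. y z * grid_inner G' h1 h2 (A (gdelta z)) w)"
      by (simp add: A.sum A.scale sumL grid_inner_linear)
    also have "\<dots> = grid_inner G h1 h2 y v"
      unfolding grid_inner_def[of G] v_def using h by (intro sum.cong) auto
    finally show ?thesis .
  qed
  then show "v \<in> grid_space G \<and>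
     (\<forall>y\<in>grid_space G. grid_inner G' h1 h2 (A y) w = grid_inner G h1 h2 y v)"
    by (auto simp: v_def grid_space_def)
  fix v' assume v': "v' \<in> grid_space G \<and>
     (\<forall>y\<in>grid_space G. grid_inner G' h1 h2 (A y) w = grid_inner G h1 h2 y v')"
  show "v' = v"
  proof
    fix z show "v' z = v z"
    proof (cases "z \<in> G")
      case True
      then have "grid_inner G' h1 h2 (A (gdelta z)) w = v' z * h1 * h2"
        using v' gdelta_mem[OF True] grid_inner_delta[OF fin(1) True] by metis
      then show ?thesis using True h by (simp add: v_def)
    next
      case False then show ?thesis using v' grid_space_outside[of v' G z] by (simp add: v_def)
    qed
  qed
qed

lemma adjoint_op_mem: "adjoint_op G G' h1 h2 A w \<in> grid_space G"
  and adjoint_op_inner: "y \<in> grid_space G \<Longrightarrow>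
    grid_inner G' h1 h2 (A y) w = grid_inner G h1 h2 y (adjoint_op G G' h1 h2 A w)"
  using theI'[OF adjoint_op_unique[of w]] unfolding adjoint_op_def by blast+

lemma adjoint_op_eqI:
  assumes "v \<in> grid_space G"
    and "\<And>y. y \<in> grid_space G \<Longrightarrow> grid_inner G' h1 h2 (A y) w = grid_inner G h1 h2 y v"
  shows "adjoint_op G G' h1 h2 A w = v"
  using adjoint_op_unique[of w] adjoint_op_mem[of w] adjoint_op_inner[of _ w] assms by blast

lemma linear_adjoint_op: "Vector_Spaces.linear scale_fun scale_fun (adjoint_op G G' h1 h2 A)"
proof (unfold_locales)
  fix x y and a :: real
  show "adjoint_op G G' h1 h2 A (x + y) = adjoint_op G G' h1 h2 A x + adjoint_op G G' h1 h2 A y"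
    using adjoint_op_mem[of x] adjoint_op_mem[of y]
    by (intro adjoint_op_eqI) (auto simp: grid_space_def grid_inner_linear adjoint_op_inner)
  show "adjoint_op G G' h1 h2 A (scale_fun a x) = scale_fun a (adjoint_op G G' h1 h2 A x)"
    using adjoint_op_mem[of x]
    by (intro adjoint_op_eqI)
      (auto simp: grid_space_def grid_inner_linear adjoint_op_inner, simp add: scale_fun_def)
qed

lemma bij_inner_op:
  assumes k: "\<And>x. x \<in> G' \<Longrightarrow> k x > 0" and \<sigma>: "\<sigma> \<ge> 0"
  shows "bij_betw (inner_op G G' h1 h2 A k \<sigma> \<tau>) (grid_space G') (grid_space G')"
proof -
  interpret A: Vector_Spaces.linear scale_fun scale_fun A by (rule lin)
  interpret As: Vector_Spaces.linear scale_fun scale_fun "adjoint_op G G' h1 h2 A"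
    by (rule linear_adjoint_op)
  let ?T = "inner_op G G' h1 h2 A k \<sigma> \<tau>"
  let ?B = "gdelta ` G'"
  interpret T: Vector_Spaces.linear scale_fun scale_fun ?T
    by unfold_locales
      (simp_all add: inner_op_def fun_eq_iff A.add As.add A.scale As.scale algebra_simps,
       simp_all add: scale_fun_def algebra_simps)
  have Tmem: "?T w \<in> grid_space G'" if "w \<in> grid_space G'" for w
    using that into[of "adjoint_op G G' h1 h2 A w"] by (auto simp: inner_op_def grid_space_def)
  have Tpos: "w = 0" if w: "w \<in> grid_space G'" and z: "?T w = 0" for w
  proof -
    let ?v = "adjoint_op G G' h1 h2 A w"
    have "0 = grid_inner G' h1 h2 (?T w) w" by (simp add: z grid_inner_def)
    also have "?T w = (\<lambda>x. inverse (k x) * w x) + scale_fun (\<sigma> * \<tau>\<^sup>2) (A ?v)"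
      by (auto simp: inner_op_def scale_fun_def)
    also have "grid_inner G' h1 h2 \<dots> w = grid_inner G' h1 h2 (\<lambda>x. inverse (k x) * w x) w
        + \<sigma> * \<tau>\<^sup>2 * grid_inner G h1 h2 ?v ?v"
      by (simp add: grid_inner_linear adjoint_op_inner adjoint_op_mem)
    finally have eq: "0 = \<dots>" .
    have "grid_inner G h1 h2 ?v ?v \<ge> 0"
      unfolding grid_inner_def using h by (intro sum_nonneg) auto
    then have 1: "\<sigma> * \<tau>\<^sup>2 * grid_inner G h1 h2 ?v ?v \<ge> 0" using \<sigma> by simp
    have nn: "inverse (k x) * w x * w x * h1 * h2 \<ge> 0" if "x \<in> G'" for x
    proof -
      have "inverse (k x) \<ge> 0" using k[OF that] by simp
      then have "inverse (k x) * (w x * w x) * h1 * h2 \<ge> 0"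
        using h by (intro mult_nonneg_nonneg zero_le_square) linarith+
      then show ?thesis by (simp add: mult.assoc)
    qed
    have "(\<Sum>x\<in>G'. inverse (k x) * w x * w x * h1 * h2) = 0"
      using eq 1 sum_nonneg[of G' "\<lambda>x. inverse (k x) * w x * w x * h1 * h2"] nn
      unfolding grid_inner_def[of G'] by force
    then have "inverse (k x) * w x * w x * h1 * h2 = 0" if "x \<in> G'" for x
      using that nn fin(2) by (simp add: sum_nonneg_eq_0_iff)
    then have "w x = 0" if "x \<in> G'" for x
      using that k[OF that] h by fastforce
    then show ?thesis using w by (auto simp: grid_space_def fun_eq_iff)
  qed
  have diff: "x - y \<in> grid_space G'" if "x \<in> grid_space G'" "y \<in> grid_space G'" for x y
    using that by (simp add: grid_space_def)
  have inj: "inj_on ?T (grid_space G')"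
  proof (rule inj_onI)
    fix x y assume xy: "x \<in> grid_space G'" "y \<in> grid_space G'" "?T x = ?T y"
    have "?T (x - y) = ?T x - ?T y" by (rule T.diff)
    also have "\<dots> = 0" unfolding xy(3) by (rule diff_self)
    finally have "?T (x - y) = 0" .
    then have "x - y = 0" by (rule Tpos[OF diff[OF xy(1,2)]])
    then show "x = y" by (simp only: right_minus_eq)
  qed
  have sub: "gf.subspace (grid_space G')"
    by (rule gf.subspaceI) (auto simp: grid_space_def scale_fun_def)
  have span: "gf.span ?B = grid_space G'"
  proof
    show "gf.span ?B \<subseteq> grid_space G'" by (rule gf.span_minimal[OF _ sub]) (auto intro: gdelta_mem)
    show "grid_space G' \<subseteq> gf.span ?B"
    proof
      fix y assume y: "y \<in> grid_space G'"
      have "(\<Sum>z\<in>G'. scale_fun (y z) (gdelta z)) \<in> gf.span ?B"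
        by (intro gf.span_sum gf.span_scale gf.span_base) auto
      then show "y \<in> gf.span ?B" using gdelta_expand[OF fin(2) y] by simp
    qed
  qed
  have ind: "gf.independent ?B"
  proof (subst gf.dependent_finite)
    show "finite ?B" using fin by simp
    have "u v = 0" if s: "(\<Sum>v\<in>?B. scale_fun (u v) v) = 0" and v: "v \<in> ?B" for u v
    proof -
      obtain z where z: "z \<in> G'" "v = gdelta z" using v by blast
      have injd: "inj_on gdelta G'" by (auto simp: inj_on_def gdelta_def fun_eq_iff split: if_splits)
      have "0 = (\<Sum>v\<in>?B. scale_fun (u v) v) z" using s by simp
      also have "\<dots> = (\<Sum>y\<in>G'. u (gdelta y) * gdelta y z)"
        unfolding sum_fun_apply by (simp add: sum.reindex[OF injd] scale_fun_def)
      also have "\<dots> = (\<Sum>y\<in>G'. if z = y then u (gdelta y) else 0)"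
        by (rule sum.cong) (simp_all add: gdelta_def[of _])
      also have "\<dots> = u v" using z fin by simp
      finally show ?thesis by simp
    qed
    then show "\<not> (\<exists>u. (\<exists>v\<in>?B. u v \<noteq> 0) \<and> (\<Sum>v\<in>?B. scale_fun (u v) v) = 0)" by blast
  qed
  have "gf.independent (?T ` ?B)"
    by (rule T.independent_injective_image) (use ind inj span in auto)
  moreover have "?T ` ?B \<subseteq> gf.span ?B" using Tmem gdelta_mem span by auto
  ultimately have "grid_space G' \<subseteq> gf.span (?T ` ?B)"
  proof -
    assume i: "gf.independent (?T ` ?B)" and s: "?T ` ?B \<subseteq> gf.span ?B"
    have cT: "card (?T ` ?B) = card ?B"
      by (rule card_image) (rule inj_on_subset[OF inj], auto intro: gdelta_mem)
    have "b \<in> gf.span (?T ` ?B)" if b: "b \<in> gf.span ?B" for b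
    proof (rule ccontr)
      assume nb: "b \<notin> gf.span (?T ` ?B)"
      then have ib: "gf.independent (insert b (?T ` ?B))"
        using i by (rule gf.independent_insertI)
      have fB: "finite ?B" using fin(2) by (rule finite_imageI)
      have "insert b (?T ` ?B) \<subseteq> gf.span ?B" using b s by (rule insert_subsetI)
      then have "card (insert b (?T ` ?B)) \<le> card ?B"
        by (rule gf.independent_span_bound[OF fB ib, THEN conjunct2])
      moreover have "b \<notin> ?T ` ?B" using nb gf.span_base by metis
      moreover have "finite (?T ` ?B)" using fB by (rule finite_imageI)
      ultimately show False using cT by (metis Suc_n_not_le_n card_insert_disjoint)
    qed
    then show ?thesis unfolding span by (rule subsetI)
  qed
  then have "grid_space G' \<subseteq> ?T ` grid_space G'"
    using T.span_image[of ?B] span by simp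
  then show ?thesis using inj Tmem by (auto simp: bij_betw_def)
qed

end

end

theory Submission
  imports Defs
begin

text \<open>
  Put \<open>g\<^sub>y = (k\<^sup>-\<^sup>1E + \<sigma>\<tau>\<^sup>2AA\<^sup>*)\<^sup>-\<^sup>1Ay\<close>.  Then
  \<open>(C\<^sub>\<alpha>y, z) = (k\<^sup>-\<^sup>1g\<^sub>y, g\<^sub>z) + \<sigma>\<tau>\<^sup>2(C\<^sub>\<alpha>y, C\<^sub>\<alpha>z)\<close>, so \<open>C\<^sub>\<alpha>\<close> is self-adjoint and nonnegative, and
  expanding \<open>\<parallel>y - \<sigma>\<tau>\<^sup>2C\<^sub>\<alpha>y\<parallel>\<^sup>2 \<ge> 0\<close> yields \<open>\<sigma>\<tau>\<^sup>2(C\<^sub>\<alpha>y, y) < \<parallel>y\<parallel>\<^sup>2\<close> for \<open>y \<noteq> 0\<close>.  Summing over the two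
  directions gives \<open>R > 0\<close> when \<open>\<nu>c\<^sub>0\<sigma> \<ge> 1/2\<close>.
  Since \<open>u\<^sup>n\<close> is a quarter of \<open>u\<^sup>n\<^sup>+\<^sup>1 + 2u\<^sup>n + u\<^sup>n\<^sup>-\<^sup>1\<close> minus a quarter of the second difference, the
  scheme reads \<open>R(d\<^sub>+ - d\<^sub>-)/\<tau> + c w + C(s\<^sub>+ + s\<^sub>-)/2 = \<phi>\<close>, with \<open>d\<^sub>\<plusminus>\<close> the one-sided difference quotients,
  \<open>s\<^sub>\<plusminus>\<close> the half sums and \<open>w\<close> the central difference quotient.  Pairing with
  \<open>2\<tau>w = \<tau>(d\<^sub>+ + d\<^sub>-) = 2(s\<^sub>+ - s\<^sub>-)\<close> telescopes to \<open>S\<^sup>n\<^sup>+\<^sup>1 - S\<^sup>n + 2\<tau>(cw, w) = 2\<tau>(\<phi>, w)\<close>,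
  and Young's inequality absorbs the right-hand side.
\<close>

section \<open>Norms from positive definite quadratic forms\<close>

text \<open>The triangle inequality is Cauchy-Schwarz for the bilinear form behind \<open>q\<close>.
  This turns positive definiteness of the energy into the claim that it is the square of a
  norm.\<close>

lemma pos_def_quadratic_form_sqrt_norm:
  assumes q: "pos_def_quadratic_form_on V s q"
    and zero: "0 \<in> V"
    and add: "\<And>x y. x \<in> V \<Longrightarrow> y \<in> V \<Longrightarrow> x + y \<in> V"
    and scale: "\<And>a x. x \<in> V \<Longrightarrow> s a x \<in> V"
  shows "is_norm_on V s (\<lambda>x. sqrt (q x))" and "\<And>x. x \<in> V \<Longrightarrow> 0 \<le> q x"
proof -
  obtain B where B: "symmetric_bilinear_on V s B" and qB: "\<And>x. x \<in> V \<Longrightarrow> q x = B x x"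
    using q unfolding pos_def_quadratic_form_on_def by blast
  have pos: "\<And>x. x \<in> V \<Longrightarrow> x \<noteq> 0 \<Longrightarrow> q x > 0"
    using q unfolding pos_def_quadratic_form_on_def by blast
  have sym: "\<And>x y. x \<in> V \<Longrightarrow> y \<in> V \<Longrightarrow> B x y = B y x"
    and Badd: "\<And>x y z. x \<in> V \<Longrightarrow> y \<in> V \<Longrightarrow> z \<in> V \<Longrightarrow> B (x + y) z = B x z + B y z"
    and Bscale: "\<And>a x z. x \<in> V \<Longrightarrow> z \<in> V \<Longrightarrow> B (s a x) z = a * B x z"
    using B unfolding symmetric_bilinear_on_def by blast+
  have B0: "B 0 z = 0" if "z \<in> V" for z using Badd[OF zero zero that] by simp
  have q0: "q 0 = 0" using qB[OF zero] B0[OF zero] by simp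
  show nonneg: "0 \<le> q x" if "x \<in> V" for x
    using pos[OF that] q0 by (cases "x = 0") auto
  have qlin: "q (s a x + s b y) = a\<^sup>2 * q x + 2 * a * b * B x y + b\<^sup>2 * q y"
    if x: "x \<in> V" and y: "y \<in> V" for a b x y
  proof -
    have [simp]: "s a x \<in> V" "s b y \<in> V" "s a x + s b y \<in> V" using x y add scale by auto
    have r: "B z (s a x + s b y) = a * B x z + b * B y z" if "z \<in> V" for z
      using that x y by (simp add: sym[of z] Badd Bscale)
    show ?thesis using x y
      by (simp add: qB r sym[OF y x] Badd Bscale sym[of x "s a x + s b y"] sym[of y "s a x + s b y"]
          power2_eq_square algebra_simps)
  qed
  have CS: "(B x y)\<^sup>2 \<le> q x * q y" if x: "x \<in> V" and y: "y \<in> V" for x y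
  proof (cases "y = 0")
    case True then show ?thesis using sym[OF x y] B0[OF x] q0 by simp
  next
    case False
    \<comment> \<open>This vector is \<open>q y\<close> times the component of \<open>x\<close> that
      is \<open>B\<close>-orthogonal to \<open>y\<close>; scaling by \<open>q y\<close> avoids a
      division.\<close>
    have "0 \<le> q (s (q y) x + s (- B x y) y)" using x y add scale by (intro nonneg) auto
    also have "\<dots> = q y * (q x * q y - (B x y)\<^sup>2)"
      by (simp add: qlin[OF x y] power2_eq_square algebra_simps)
    finally show ?thesis using pos[OF y False] by (simp add: zero_le_mult_iff)
  qed
  have qadd: "q (x + y) = q x + 2 * B x y + q y" if x: "x \<in> V" and y: "y \<in> V" for x y
    using x y add by (simp add: qB Badd sym[of x "x + y"] sym[of y "x + y"] sym[OF y x])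
  have "sqrt (q (x + y)) \<le> sqrt (q x) + sqrt (q y)" if x: "x \<in> V" and y: "y \<in> V" for x y
  proof (rule real_le_lsqrt)
    have "B x y \<le> sqrt (q x * q y)" using CS[OF x y] by (rule real_le_rsqrt)
    then show "q (x + y) \<le> (sqrt (q x) + sqrt (q y))\<^sup>2"
      using nonneg[OF x] nonneg[OF y] by (simp add: qadd[OF x y] power2_sum real_sqrt_mult)
  qed (use nonneg x y in auto)
  moreover have "q (s a x) = a\<^sup>2 * q x" if "x \<in> V" for a x
    using that scale[OF that] by (simp add: qB Bscale sym[of x "s a x"] power2_eq_square)
  moreover have "sqrt (q x) = 0 \<longleftrightarrow> x = 0" if "x \<in> V" for x
    using pos[OF that] q0 by (cases "x = 0") auto
  ultimately show "is_norm_on V s (\<lambda>x. sqrt (q x))"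
    using nonneg by (auto simp: is_norm_on_def real_sqrt_mult)
qed

section \<open>Grid functions and weighted scalar products\<close>

lemma grid_space_closed:
  "0 \<in> grid_space G"
  "y \<in> grid_space G \<Longrightarrow> z \<in> grid_space G \<Longrightarrow> y + z \<in> grid_space G"
  "y \<in> grid_space G \<Longrightarrow> z \<in> grid_space G \<Longrightarrow> y - z \<in> grid_space G"
  "y \<in> grid_space G \<Longrightarrow> scale_fun a y \<in> grid_space G"
  by (auto simp: grid_space_def scale_fun_def)

lemma grid_inner_commute: "grid_inner G h1 h2 y z = grid_inner G h1 h2 z y"
  by (simp add: grid_inner_def mult.commute)

lemma grid_inner_minus:
  "grid_inner G h1 h2 (y - z) w = grid_inner G h1 h2 y w - grid_inner G h1 h2 z w"
  "grid_inner G h1 h2 w (y - z) = grid_inner G h1 h2 w y - grid_inner G h1 h2 w z"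
  by (simp_all add: grid_inner_def algebra_simps sum_subtractf)

lemma grid_inner_weighted_nonneg:
  assumes "h1 > 0" "h2 > 0" "\<And>x. x \<in> G \<Longrightarrow> 0 \<le> a x"
  shows "0 \<le> grid_inner G h1 h2 (\<lambda>x. a x * y x) y"
  unfolding grid_inner_def
proof (intro sum_nonneg)
  fix x assume "x \<in> G"
  then have "0 \<le> a x * (y x * y x) * h1 * h2" using assms by simp
  then show "0 \<le> a x * y x * y x * h1 * h2" by (simp add: mult.assoc)
qed

lemma grid_inner_weighted_pos:
  assumes "finite G" "h1 > 0" "h2 > 0" "\<And>x. x \<in> G \<Longrightarrow> 0 < a x" "y \<in> grid_space G" "y \<noteq> 0"
  shows "0 < grid_inner G h1 h2 (\<lambda>x. a x * y x) y"
proof -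
  obtain z where z: "y z \<noteq> 0" using assms(6) by (auto simp: fun_eq_iff)
  then have zG: "z \<in> G" using assms(5) by (metis grid_space_outside)
  have "0 \<le> a x * (y x * y x) * h1 * h2" if "x \<in> G" for x
    using assms(2,3) less_imp_le[OF assms(4)[OF that]] by simp
  moreover have "0 < a z * (y z * y z) * h1 * h2"
  proof -
    have "0 < y z * y z" using z not_real_square_gt_zero by blast
    then show ?thesis using assms(2,3) assms(4)[OF zG] by (metis mult_pos_pos)
  qed
  ultimately have "0 < (\<Sum>x\<in>G. a x * (y x * y x) * h1 * h2)"
    using assms(1) zG by (intro sum_pos2[of G z])
  then show ?thesis by (simp add: grid_inner_def mult.assoc)
qed

lemmas grid_inner_self_nonneg = grid_inner_weighted_nonneg[where a = "\<lambda>_. 1", simplified]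
  and grid_inner_self_pos = grid_inner_weighted_pos[where a = "\<lambda>_. 1", simplified]

section \<open>The operator of one coordinate direction\<close>

text \<open>Abstracts from the direction, so that both summands of \<open>C\<close> are
  instances.\<close>

locale regularized_factor =
  fixes G G' :: "(real \<times> real) set" and h1 h2 :: real and A :: "gridfun \<Rightarrow> gridfun"
    and k :: gridfun and \<sigma> \<tau> :: real
  assumes fin: "finite G" "finite G'" and h: "h1 > 0" "h2 > 0"
    and lin: "Vector_Spaces.linear scale_fun scale_fun A"
    and into: "\<And>y. A y \<in> grid_space G'"
    and k: "\<And>x. x \<in> G' \<Longrightarrow> k x > 0" and \<sigma>: "\<sigma> > 0" and \<tau>: "\<tau> > 0"
begin

interpretation A: Vector_Spaces.linear scale_fun scale_fun A by (rule lin)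
interpretation As: Vector_Spaces.linear scale_fun scale_fun "adjoint_op G G' h1 h2 A"
  by (rule linear_adjoint_op[OF fin h lin into])

abbreviation "ip \<equiv> grid_inner G h1 h2"
abbreviation "ip' \<equiv> grid_inner G' h1 h2"
abbreviation "K \<equiv> inner_op G G' h1 h2 A k \<sigma> \<tau>"
abbreviation "Cp \<equiv> Cpart G G' h1 h2 A k \<sigma> \<tau>"

text \<open>With the term in \<sigma> dropped, this would be the usual discrete flux,
  \<open>k\<close> times \<open>A y\<close>.\<close>

definition flux :: "gridfun \<Rightarrow> gridfun" where
  "flux y = inv_into (grid_space G') K (A y)"

lemma bij_K: "bij_betw K (grid_space G') (grid_space G')"
  using bij_inner_op[OF fin h lin into, of k \<sigma>] k \<sigma> by simp

lemma flux_mem: "flux y \<in> grid_space G'"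
  unfolding flux_def using bij_K into by (metis bij_betw_imp_surj_on inv_into_into)

lemma K_flux: "K (flux y) = A y"
  unfolding flux_def using bij_K into by (metis bij_betw_inv_into_right)

text \<open>Injectivity of \<open>K\<close> on the grid space lets linearity of \<open>flux\<close>
  be checked after applying \<open>K\<close>.\<close>

lemma flux_eqI: "w \<in> grid_space G' \<Longrightarrow> K w = A y \<Longrightarrow> flux y = w"
  unfolding flux_def using bij_K by (metis bij_betw_inv_into_left)

lemma Cpart_flux: "Cp y = adjoint_op G G' h1 h2 A (flux y)"
  by (simp add: Cpart_def flux_def)

lemma flux_add: "flux (y + z) = flux y + flux z"
proof (rule flux_eqI)
  show "flux y + flux z \<in> grid_space G'" by (intro grid_space_closed flux_mem)
  have "K (flux y + flux z) = K (flux y) + K (flux z)"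
    by (simp add: inner_op_def fun_eq_iff A.add As.add algebra_simps)
  then show "K (flux y + flux z) = A (y + z)" by (simp add: K_flux A.add)
qed

lemma flux_scale: "flux (scale_fun a y) = scale_fun a (flux y)"
proof (rule flux_eqI)
  show "scale_fun a (flux y) \<in> grid_space G'" by (intro grid_space_closed flux_mem)
  have "K (scale_fun a (flux y)) = scale_fun a (K (flux y))"
    by (simp add: inner_op_def fun_eq_iff A.scale As.scale) (simp add: scale_fun_def algebra_simps)
  then show "K (scale_fun a (flux y)) = A (scale_fun a y)" by (simp add: K_flux A.scale)
qed

lemma Cpart_add: "Cp (y + z) = Cp y + Cp z"
  by (simp add: Cpart_flux flux_add As.add)

lemma Cpart_scale: "Cp (scale_fun a y) = scale_fun a (Cp y)"
  by (simp add: Cpart_flux flux_scale As.scale)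

lemma Cpart_mem: "Cp y \<in> grid_space G"
  unfolding Cpart_flux by (rule adjoint_op_mem[OF fin h lin into])

text \<open>Move the adjoint onto \<open>z\<close>, write \<open>A z\<close> as
  \<open>K (flux z)\<close>, and move \<open>A\<close> back in the regularizing term. The right-hand
  side is visibly symmetric, and nonnegative for equal arguments.\<close>

lemma Cpart_form:
  assumes "z \<in> grid_space G"
  shows "ip (Cp y) z =
    ip' (\<lambda>x. inverse (k x) * flux y x) (flux z) + \<sigma> * \<tau>\<^sup>2 * ip (Cp y) (Cp z)"
proof -
  have "ip (Cp y) z = ip' (A z) (flux y)"
    by (simp add: Cpart_flux grid_inner_commute[of G] adjoint_op_inner[OF fin h lin into assms])
  also have "A z = (\<lambda>x. inverse (k x) * flux z x) + scale_fun (\<sigma> * \<tau>\<^sup>2) (A (Cp z))"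
    by (subst K_flux[symmetric]) (auto simp: inner_op_def scale_fun_def Cpart_flux)
  also have "ip' \<dots> (flux y) =
      ip' (\<lambda>x. inverse (k x) * flux z x) (flux y) + \<sigma> * \<tau>\<^sup>2 * ip' (A (Cp z)) (flux y)"
    by (simp add: grid_inner_linear)
  also have "ip' (A (Cp z)) (flux y) = ip (Cp z) (Cp y)"
    unfolding Cpart_flux[of y] by (rule adjoint_op_inner[OF fin h lin into Cpart_mem])
  also have "ip' (\<lambda>x. inverse (k x) * flux z x) (flux y)
      = ip' (\<lambda>x. inverse (k x) * flux y x) (flux z)"
    by (simp add: grid_inner_def mult.assoc mult.left_commute)
  finally show ?thesis by (simp add: grid_inner_commute)
qed

lemma Cpart_self_adjoint:
  assumes "y \<in> grid_space G" "z \<in> grid_space G"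
  shows "ip (Cp y) z = ip y (Cp z)"
proof -
  have "ip' (\<lambda>x. inverse (k x) * flux z x) (flux y)
      = ip' (\<lambda>x. inverse (k x) * flux y x) (flux z)"
    by (simp add: grid_inner_def mult.assoc mult.left_commute)
  then show ?thesis
    using Cpart_form[OF assms(2), of y] Cpart_form[OF assms(1), of z]
    by (simp add: grid_inner_commute)
qed

lemma Cpart_nonneg: "y \<in> grid_space G \<Longrightarrow> 0 \<le> ip (Cp y) y"
  using k \<sigma> h grid_inner_self_nonneg[of h1 h2 G "Cp y"]
    grid_inner_weighted_nonneg[of h1 h2 G' "\<lambda>x. inverse (k x)" "flux y"]
  by (subst Cpart_form) (auto intro!: add_nonneg_nonneg simp: less_imp_le)

text \<open>The term of \<open>Cpart_form\<close> weighted by the inverse of \<open>k\<close> is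
  strictly positive. It is the source of strictness in both \<open>Cpart_pos\<close> and
  \<open>Cpart_less\<close>.\<close>

lemma flux_nonzero_less:
  assumes "y \<in> grid_space G" "flux y \<noteq> 0"
  shows "\<sigma> * \<tau>\<^sup>2 * ip (Cp y) (Cp y) < ip (Cp y) y"
  using Cpart_form[OF assms(1), of y] k h fin flux_mem assms(2)
    grid_inner_weighted_pos[of G' h1 h2 "\<lambda>x. inverse (k x)" "flux y"]
  by simp

text \<open>A zero flux would give \<open>A y = K 0 = 0\<close>, so the strict bound for nonzero
  flux applies.\<close>

lemma Cpart_pos:
  assumes "y \<in> grid_space G" "A y \<noteq> 0"
  shows "0 < ip (Cp y) y"
proof -
  have "K 0 = 0" by (simp add: inner_op_def fun_eq_iff A.zero As.zero)
  then have "flux y \<noteq> 0" using K_flux[of y] assms(2) by auto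
  then have "\<sigma> * \<tau>\<^sup>2 * ip (Cp y) (Cp y) < ip (Cp y) y" by (rule flux_nonzero_less[OF assms(1)])
  moreover have "0 \<le> \<sigma> * \<tau>\<^sup>2 * ip (Cp y) (Cp y)"
    using \<sigma> h by (simp add: grid_inner_self_nonneg)
  ultimately show ?thesis by linarith
qed

lemma Cpart_less:
  assumes y: "y \<in> grid_space G" "y \<noteq> 0"
  shows "\<sigma> * \<tau>\<^sup>2 * ip (Cp y) y < ip y y"
proof (cases "flux y = 0")
  \<comment> \<open>Here the flux gives no strictness, but \<open>Cp y\<close> vanishes and the
    claim reduces to positivity of the norm of \<open>y\<close>.\<close>
  case True
  then have "Cp y = 0" by (simp add: Cpart_flux As.zero)
  then have "ip (Cp y) y = 0" by (simp add: grid_inner_def)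
  then show ?thesis using grid_inner_self_pos[OF fin(1) h y] by simp
next
  case False
  let ?e = "\<sigma> * \<tau>\<^sup>2"
  have "0 \<le> ip (y - scale_fun ?e (Cp y)) (y - scale_fun ?e (Cp y))"
    by (rule grid_inner_self_nonneg[OF h])
  also have "\<dots> = ip y y - 2 * ?e * ip (Cp y) y + ?e * (?e * ip (Cp y) (Cp y))"
    by (simp add: grid_inner_minus grid_inner_linear grid_inner_commute[of G _ _ y "Cp y"]
        algebra_simps)
  \<comment> \<open>The quadratic term is absorbed by one of the two copies of the cross term; the
    other copy is the bound sought.\<close>
  also have "\<dots> < ip y y - 2 * ?e * ip (Cp y) y + ?e * ip (Cp y) y"
    using flux_nonzero_less[OF y(1) False] \<sigma> \<tau> by simp
  finally show ?thesis by (simp add: algebra_simps)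
qed

end

section \<open>The energy form and its evolution over one time step\<close>

text \<open>The energy is the form of \<open>R\<close> plus that of \<open>C\<close>, pulled back
  along the linear injective map from a pair to its difference quotient \<open>d\<close> and half
  sum \<open>m\<close>.\<close>

lemma pos_def_quadratic_form_energy:
  assumes R: "pos_def_operator_on (grid_space G) scale_fun (grid_inner G h1 h2) R"
    and C: "pos_def_operator_on (grid_space G) scale_fun (grid_inner G h1 h2) C"
    and \<tau>: "\<tau> > 0"
  shows "pos_def_quadratic_form_on (grid_space G \<times> grid_space G) scale_pair
    (energy (grid_inner G h1 h2) R C \<tau>)"
proof -
  let ?H = "grid_space G" and ?ip = "grid_inner G h1 h2"
  define d where "d z = scale_fun (1 / \<tau>) (fst z - snd z)" for z :: "gridfun \<times> gridfun"
  define m where "m z = scale_fun (1 / 2) (fst z + snd z)" for z :: "gridfun \<times> gridfun"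
  define B where "B z w = ?ip (R (d z)) (d w) + ?ip (C (m z)) (m w)" for z w
  have mem: "d z \<in> ?H" "m z \<in> ?H" if "z \<in> ?H \<times> ?H" for z
    using that by (auto simp: d_def m_def intro!: grid_space_closed)
  have dm: "d (z + w) = d z + d w" "m (z + w) = m z + m w"
    "d (scale_pair a z) = scale_fun a (d z)" "m (scale_pair a z) = scale_fun a (m z)" for z w a
    by (simp_all add: d_def m_def scale_pair_def scale_fun_def fun_eq_iff algebra_simps
        diff_divide_distrib add_divide_distrib)
  have "symmetric_bilinear_on (?H \<times> ?H) scale_pair B"
    unfolding symmetric_bilinear_on_def
  proof (intro conjI ballI allI)
    fix x y z and a :: real
    assume x: "x \<in> ?H \<times> ?H" and y: "y \<in> ?H \<times> ?H"
    show "B x y = B y x"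
      using R C mem[OF x] mem[OF y]
      by (simp add: B_def pos_def_operator_on_def grid_inner_commute[of G h1 h2 "R (d y)"]
          grid_inner_commute[of G h1 h2 "C (m y)"])
    show "B (x + y) z = B x z + B y z"
      using R C mem[OF x] mem[OF y]
      by (simp add: B_def dm pos_def_operator_on_def grid_inner_linear)
  next
    fix x z and a :: real
    assume x: "x \<in> ?H \<times> ?H"
    show "B (scale_pair a x) z = a * B x z"
      using R C mem[OF x]
      by (simp add: B_def dm pos_def_operator_on_def grid_inner_linear algebra_simps)
  qed
  moreover have E: "energy ?ip R C \<tau> z = B z z" for z
    by (cases z) (simp add: energy_def B_def d_def m_def scale_fun_def fun_diff_def plus_fun_def)
  moreover have "B z z > 0" if z: "z \<in> ?H \<times> ?H" "z \<noteq> 0" for z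
  proof -
    have nn: "0 \<le> ?ip (R y) y" "0 \<le> ?ip (C y) y" if "y \<in> ?H" for y
    proof -
      have "?ip y 0 = 0" for y by (simp add: grid_inner_def)
      then show "0 \<le> ?ip (R y) y" "0 \<le> ?ip (C y) y"
        using R C that by (cases "y = 0"; force simp: pos_def_operator_on_def)+
    qed
    \<comment> \<open>If both vanish, the components are equal as well as opposite, hence
      zero.\<close>
    have "d z \<noteq> 0 \<or> m z \<noteq> 0"
    proof (rule ccontr)
      assume "\<not> ?thesis"
      then have "d z x = 0" "m z x = 0" for x by simp_all
      then have "fst z x - snd z x = 0" "fst z x + snd z x = 0" for x
        using \<tau> by (simp_all add: d_def m_def scale_fun_def)
      then have "fst z x = 0" "snd z x = 0" for x by (smt (verit))+
      then have "fst z = 0" "snd z = 0" by (auto simp: fun_eq_iff)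
      then show False using z(2) by (simp add: prod_eq_iff)
    qed
    then have "0 < ?ip (R (d z)) (d z) \<or> 0 < ?ip (C (m z)) (m z)"
      using R C mem[OF z(1)] by (auto simp: pos_def_operator_on_def)
    then show ?thesis using nn mem[OF z(1)] unfolding B_def by (smt (verit))
  qed
  ultimately show ?thesis unfolding pos_def_quadratic_form_on_def by auto
qed

text \<open>The inequality holds node by node. The constants are such that the dissipation
  \<open>2 * t\<close> is used up exactly.\<close>

lemma weighted_Young:
  assumes "h1 > 0" "h2 > 0" "t > 0" "\<And>x. x \<in> G \<Longrightarrow> 0 < c x"
  shows "2 * t * grid_inner G h1 h2 p w \<le> 2 * t * grid_inner G h1 h2 (\<lambda>x. c x * w x) w
    + t / 2 * grid_inner G h1 h2 (\<lambda>x. inverse (c x) * p x) p"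
proof -
  have "2 * t * (p x * w x * h1 * h2) \<le> 2 * t * (c x * w x * w x * h1 * h2)
      + t / 2 * (inverse (c x) * p x * p x * h1 * h2)" if "x \<in> G" for x
  proof -
    have c: "c x > 0" using assms(4) that .
    \<comment> \<open>Expanding this square gives precisely the difference of the two sides.\<close>
    have "0 \<le> t / 2 * h1 * h2 * (inverse (c x) * (p x - 2 * c x * w x)\<^sup>2)"
      using assms(1-3) c by simp
    also have "\<dots> = 2 * t * (c x * w x * w x * h1 * h2)
      + t / 2 * (inverse (c x) * p x * p x * h1 * h2) - 2 * t * (p x * w x * h1 * h2)"
      using c by (simp add: field_simps power2_eq_square)
    finally show ?thesis by simp
  qed
  then show ?thesis
    unfolding grid_inner_def sum_distrib_left sum.distrib[symmetric] by (rule sum_mono)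
qed

text \<open>Here \<open>y\<close>, \<open>v\<close>, \<open>z\<close> are the new, middle and old
  time levels. Testing the scheme with the central difference quotient \<open>w\<close> makes the
  energies telescope.\<close>

lemma energy_step:
  assumes h: "h1 > 0" "h2 > 0" and \<tau>: "\<tau> > 0" and c: "\<And>x. x \<in> G \<Longrightarrow> 0 < c x"
    and R: "pos_def_operator_on (grid_space G) scale_fun (grid_inner G h1 h2) R"
    and C: "pos_def_operator_on (grid_space G) scale_fun (grid_inner G h1 h2) C"
    and RC: "\<And>y x. R y x = \<nu> * c x * y x - \<tau>\<^sup>2 / 4 * C y x"
    and mem: "y \<in> grid_space G" "v \<in> grid_space G" "z \<in> grid_space G"
    and scheme: "\<And>x. x \<in> G \<Longrightarrow> \<nu> * c x * ((y x - 2 * v x + z x) / \<tau>\<^sup>2)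
      + c x * ((y x - z x) / (2 * \<tau>)) + C v x = p x"
  shows "energy (grid_inner G h1 h2) R C \<tau> (y, v) \<le> energy (grid_inner G h1 h2) R C \<tau> (v, z)
    + \<tau> / 2 * grid_inner G h1 h2 (\<lambda>x. inverse (c x) * p x) p"
proof -
  let ?H = "grid_space G" and ?ip = "grid_inner G h1 h2"
  define d1 d2 m1 m2 where "d1 = scale_fun (1 / \<tau>) (y - v)" "d2 = scale_fun (1 / \<tau>) (v - z)"
    "m1 = scale_fun (1 / 2) (y + v)" "m2 = scale_fun (1 / 2) (v + z)"
  note defs = this
  define w where "w = scale_fun (1 / (2 * \<tau>)) (y - z)"
  have E: "energy ?ip R C \<tau> (y, v) = ?ip (R d1) d1 + ?ip (C m1) m1"
    "energy ?ip R C \<tau> (v, z) = ?ip (R d2) d2 + ?ip (C m2) m2"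
    by (simp_all add: energy_def defs scale_fun_def fun_diff_def plus_fun_def)
  have dH: "d1 \<in> ?H" "d2 \<in> ?H" "m1 \<in> ?H" "m2 \<in> ?H"
    using mem by (auto simp: defs intro!: grid_space_closed)
  have diff: "O' (a - b) = O' a - O' b"
    if "pos_def_operator_on ?H scale_fun ?ip O'" "a \<in> ?H" "b \<in> ?H" for O' a b
  proof -
    have "O' (a - b + b) = O' (a - b) + O' b"
      using that grid_space_closed(3)[OF that(2,3)] unfolding pos_def_operator_on_def by blast
    then show ?thesis by simp
  qed
  have scheme': "?ip p w = ?ip (scale_fun (1 / \<tau>) (R d1 - R d2) + (\<lambda>x. c x * w x)
      + scale_fun (1 / 2) (C m1 + C m2)) w"
  proof -
    let ?e = "scale_fun (1 / \<tau>) (d1 - d2)"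
    have eH: "?e \<in> ?H" "v \<in> ?H" using dH mem by (auto intro!: grid_space_closed)
    have 1: "scale_fun (1 / \<tau>) (R d1 - R d2) = R ?e"
      using R dH grid_space_closed(3)[OF dH(1,2)]
      by (simp add: pos_def_operator_on_def diff[OF R])
    \<comment> \<open>The mean of the half sums exceeds \<open>v\<close> by a quarter of the second
      difference. The resulting extra \<open>C\<close> term cancels the one subtracted in
      \<open>R\<close>.\<close>
    have 2: "scale_fun (1 / 2) (C m1 + C m2) = C (v + scale_fun (\<tau>\<^sup>2 / 4) ?e)"
    proof -
      have "scale_fun (1 / 2) (C m1 + C m2) = C (scale_fun (1 / 2) (m1 + m2))"
        using C dH grid_space_closed(2)[OF dH(3,4)] by (simp add: pos_def_operator_on_def)
      also have "scale_fun (1 / 2) (m1 + m2) = v + scale_fun (\<tau>\<^sup>2 / 4) ?e"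
        using \<tau> by (simp add: fun_eq_iff defs scale_fun_def field_simps power2_eq_square)
      finally show ?thesis .
    qed
    have 3: "C (v + scale_fun (\<tau>\<^sup>2 / 4) ?e) = C v + scale_fun (\<tau>\<^sup>2 / 4) (C ?e)"
      using C eH grid_space_closed(4)[OF eH(1)] unfolding pos_def_operator_on_def by metis
    \<comment> \<open>Equality at the nodes of \<open>G\<close> suffices, since the scalar product
      sums over \<open>G\<close> alone.\<close>
    have "p x = (scale_fun (1 / \<tau>) (R d1 - R d2) + (\<lambda>x. c x * w x)
        + scale_fun (1 / 2) (C m1 + C m2)) x" if "x \<in> G" for x
    proof -
      have e: "?e x = (y x - 2 * v x + z x) / \<tau>\<^sup>2"
        using \<tau> by (simp add: defs scale_fun_def field_simps power2_eq_square)
      have w: "w x = (y x - z x) / (2 * \<tau>)"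
        by (simp add: w_def scale_fun_def)
      show ?thesis
        unfolding 1 2 3 by (simp add: RC e w flip: scheme[OF that]) (simp add: scale_fun_def)
    qed
    then show ?thesis unfolding grid_inner_def by (intro sum.cong) auto
  qed
  \<comment> \<open>The first form pairs with \<open>R d1 - R d2\<close>, the second with
    \<open>C m1 + C m2\<close>; by symmetry the mixed terms cancel in each product.\<close>
  have w: "w = scale_fun (1 / 2) (d1 + d2)" "w = scale_fun (1 / \<tau>) (m1 - m2)"
    using \<tau> by (simp_all add: fun_eq_iff w_def defs scale_fun_def field_simps)
  have sym: "?ip (R d1) d2 = ?ip (R d2) d1" "?ip (C m1) m2 = ?ip (C m2) m1"
    using R C dH by (simp_all add: pos_def_operator_on_def grid_inner_commute)
  have a: "?ip (R d1 - R d2) w = (?ip (R d1) d1 - ?ip (R d2) d2) / 2"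
    unfolding w(1) by (simp add: grid_inner_linear grid_inner_minus sym algebra_simps)
  have b: "?ip (C m1) w + ?ip (C m2) w = (?ip (C m1) m1 - ?ip (C m2) m2) / \<tau>"
    unfolding w(2) by (simp add: grid_inner_linear grid_inner_minus sym flip: add_divide_distrib)
  have "2 * \<tau> * ?ip p w = ?ip (R d1) d1 - ?ip (R d2) d2 + 2 * \<tau> * ?ip (\<lambda>x. c x * w x) w
      + (?ip (C m1) m1 - ?ip (C m2) m2)"
    unfolding scheme' grid_inner_linear(1,3) a b using \<tau> by (simp add: field_simps)
  then show ?thesis
    using weighted_Young[of h1 h2 \<tau> G c p w, OF h \<tau> c] unfolding E by simp
qed

section \<open>Geometry of the grids\<close>

text \<open>A vanishing difference quotient makes \<open>y\<close> constant along each horizontal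
  grid line, and it is zero on the left boundary. So one direction alone makes \<open>C\<close>
  definite.\<close>

lemma A1_eq_0_imp_eq_0:
  assumes y: "y \<in> grid_space (omega h1 h2 N1 N2)" and h: "h1 > 0" "h2 > 0" and N: "N1 \<ge> 1"
    and A: "A1 h1 h2 N1 N2 y = 0"
  shows "y = 0"
proof -
  have step: "y (real (Suc i) * h1, real j * h2) = y (real i * h1, real j * h2)"
    if "i \<le> N1 - 1" "1 \<le> j" "j \<le> N2 - 1" for i j
  proof -
    have "((real i + 1 / 2) * h1, real j * h2) \<in> omega1 h1 h2 N1 N2"
      using that by (auto simp: omega1_def)
    then have "A1 h1 h2 N1 N2 y ((real i + 1 / 2) * h1, real j * h2) =
      (y ((real i + 1 / 2) * h1 + h1 / 2, real j * h2)
        - y ((real i + 1 / 2) * h1 - h1 / 2, real j * h2)) / h1"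
      by (simp add: A1_def)
    moreover have "(real i + 1 / 2) * h1 + h1 / 2 = real (Suc i) * h1"
      "(real i + 1 / 2) * h1 - h1 / 2 = real i * h1" by (simp_all add: algebra_simps)
    ultimately show ?thesis using A h by simp
  qed
  have col: "y (real i * h1, real j * h2) = 0"
    if "i \<le> N1" "1 \<le> j" "j \<le> N2 - 1" for i j
    using that(1)
  proof (induction i)
    \<comment> \<open>The node of index 0 lies outside \<open>omega\<close>, where the encoding
      makes \<open>y\<close> zero.\<close>
    case 0
    have "(real 0 * h1, real j * h2) \<notin> omega h1 h2 N1 N2" using h by (auto simp: omega_def)
    then show ?case using y by (simp add: grid_space_def)
  next
    case (Suc i) then show ?case using step[of i j] that by simp
  qed
  show ?thesis
  proof
    fix x show "y x = 0 x"
    proof (cases "x \<in> omega h1 h2 N1 N2")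
      case True
      then obtain i j where "x = (real i * h1, real j * h2)" "i \<le> N1 - 1" "1 \<le> j" "j \<le> N2 - 1"
        by (auto simp: omega_def)
      then show ?thesis using col[of i j] by simp
    next
      case False
      then show ?thesis using y by (simp add: grid_space_outside)
    qed
  qed
qed

text \<open>The bounds on \<open>c\<close> and \<open>k\<close> are assumed on the open rectangle;
  this transfers them to the nodes. Half-integer nodes stay inside because
  \<open>i + 1/2 < N\<close> for \<open>i \<le> N - 1\<close>.\<close>

lemma grid_points_inside:
  assumes "l1 > 0" "l2 > 0" "N1 \<ge> 1" "N2 \<ge> 1" "h1 = l1 / real N1" "h2 = l2 / real N2"
  shows "omega h1 h2 N1 N2 \<subseteq> {0<..<l1} \<times> {0<..<l2}"
    and "omega1 h1 h2 N1 N2 \<subseteq> {0<..<l1} \<times> {0<..<l2}"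
    and "omega2 h1 h2 N1 N2 \<subseteq> {0<..<l1} \<times> {0<..<l2}"
proof -
  have full: "0 < real i * (l / real N)" "real i * (l / real N) < l"
    if "l > 0" "N \<ge> 1" "1 \<le> i" "i \<le> N - 1" for i N :: nat and l :: real
  proof -
    have "real i < real N" using that by linarith
    then show "0 < real i * (l / real N)" "real i * (l / real N) < l"
      using that by (simp_all add: field_simps)
  qed
  have half: "0 < (real i + 1 / 2) * (l / real N)" "(real i + 1 / 2) * (l / real N) < l"
    if "l > 0" "N \<ge> 1" "i \<le> N - 1" for i N :: nat and l :: real
  proof -
    have "real i + 1 / 2 < real N" using that by linarith
    then have "(real i + 1 / 2) * l < real N * l" using that by simp
    then show "0 < (real i + 1 / 2) * (l / real N)" "(real i + 1 / 2) * (l / real N) < l"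
      using that by (simp_all add: field_simps add_pos_nonneg)
  qed
  show "omega h1 h2 N1 N2 \<subseteq> {0<..<l1} \<times> {0<..<l2}"
    using full[OF assms(1,3)] full[OF assms(2,4)] by (clarsimp simp: omega_def assms(5,6))
  show "omega1 h1 h2 N1 N2 \<subseteq> {0<..<l1} \<times> {0<..<l2}"
    using half[OF assms(1,3)] full[OF assms(2,4)] by (clarsimp simp: omega1_def assms(5,6))
  show "omega2 h1 h2 N1 N2 \<subseteq> {0<..<l1} \<times> {0<..<l2}"
    using full[OF assms(1,3)] half[OF assms(2,4)] by (clarsimp simp: omega2_def assms(5,6))
qed

section \<open>Unconditional stability of the two-dimensional scheme\<close>

theorem theorem6p2:
  fixes l1 l2 h1 h2 c0 k0 k1 \<nu> \<sigma> \<tau> T :: real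
    and N1 N2 N :: nat
    and c k :: "real \<times> real \<Rightarrow> real"
    and H :: "gridfun set"
    and ip :: "gridfun \<Rightarrow> gridfun \<Rightarrow> real"
    and C R :: "gridfun \<Rightarrow> gridfun"
    and Q :: "gridfun \<times> gridfun \<Rightarrow> real"
    and u f \<phi> :: "nat \<Rightarrow> gridfun"
    and v0 w0 :: gridfun
    and S :: "nat \<Rightarrow> real"
  assumes "l1 > 0" and "l2 > 0" and "N1 \<ge> 2" and "N2 \<ge> 2"
    and h1: "h1 = l1 / real N1" and h2: "h2 = l2 / real N2"
    and "c0 > 0" and c: "\<And>x. x \<in> {0<..<l1} \<times> {0<..<l2} \<Longrightarrow> c0 \<le> c x"
    and "k0 > 0" and k: "\<And>x. x \<in> {0<..<l1} \<times> {0<..<l2} \<Longrightarrow> k0 \<le> k x \<and> k x \<le> k1"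
    and "\<nu> > 0" and "\<tau> > 0" and "N \<ge> 2" and T: "real N * \<tau> = T"
    and \<sigma>: "\<nu> * c0 * \<sigma> \<ge> 1/2"
    and H: "H = grid_space (omega h1 h2 N1 N2)"
    and ip: "ip = grid_inner (omega h1 h2 N1 N2) h1 h2"
    and C: "C = Cop h1 h2 N1 N2 k \<sigma> \<tau>"
    and R: "R = Rop h1 h2 N1 N2 c k \<nu> \<sigma> \<tau>"
    and u: "\<And>n. n \<le> N \<Longrightarrow> u n \<in> H"
    and f: "\<And>n. n \<le> N \<Longrightarrow> f n \<in> H"
    and "v0 \<in> H" and "w0 \<in> H"
    and \<phi>: "\<And>n x. 1 \<le> n \<Longrightarrow> n \<le> N - 1 \<Longrightarrow>
          \<phi> n x = f n x + \<nu> * ((f (n + 1) x - f (n - 1) x) / (2 * \<tau>))"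
    and scheme: "\<And>n x. 1 \<le> n \<Longrightarrow> n \<le> N - 1 \<Longrightarrow> x \<in> omega h1 h2 N1 N2 \<Longrightarrow>
          \<nu> * c x * ((u (n + 1) x - 2 * u n x + u (n - 1) x) / \<tau>\<^sup>2)
          + c x * ((u (n + 1) x - u (n - 1) x) / (2 * \<tau>)) + C (u n) x = \<phi> n x"
    and init0: "u 0 = v0"
    and init1: "\<And>x. (u 1 x - u 0 x) / \<tau> = w0 x"
    and Q: "Q = energy ip R C \<tau>"
    and S: "\<And>n. 1 \<le> n \<Longrightarrow> n \<le> N \<Longrightarrow> S n = Q (u n, u (n - 1))"
  shows "pos_def_operator_on H scale_fun ip R
    \<and> pos_def_quadratic_form_on (H \<times> H) scale_pair Q
    \<and> (\<exists>p. is_norm_on (H \<times> H) scale_pair p \<and> (\<forall>z\<in>H \<times> H. Q z = (p z)\<^sup>2))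
    \<and> (\<forall>n. 1 \<le> n \<and> n \<le> N - 1 \<longrightarrow>
          S (n + 1) \<le> S n + \<tau> / 2 * ip (\<lambda>x. inverse (c x) * \<phi> n x) (\<phi> n))"
proof -
  have h: "h1 > 0" "h2 > 0" using assms(1-4) by (simp_all add: h1 h2)
  have \<sigma>0: "\<sigma> > 0"
  proof (rule ccontr)
    assume "\<not> \<sigma> > 0"
    then have "\<nu> * c0 * \<sigma> \<le> 0" using \<open>\<nu> > 0\<close> \<open>c0 > 0\<close> by (simp add: mult_nonneg_nonpos)
    then show False using \<sigma> by simp
  qed
  have "N1 \<ge> 1" "N2 \<ge> 1" using assms(3,4) by simp_all
  note inside = grid_points_inside[OF assms(1,2) this h1 h2]
  let ?G = "omega h1 h2 N1 N2" and ?G1 = "omega1 h1 h2 N1 N2" and ?G2 = "omega2 h1 h2 N1 N2"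
  have cG: "c0 \<le> c x" if "x \<in> ?G" for x using that inside(1) c by blast
  have kG: "k x > 0" if "x \<in> ?G1 \<or> x \<in> ?G2" for x
    using that inside(2,3) k[of x] \<open>k0 > 0\<close> by force
  interpret P1: regularized_factor ?G ?G1 h1 h2 "A1 h1 h2 N1 N2" k \<sigma> \<tau>
    using h kG \<sigma>0 \<open>\<tau> > 0\<close> 
    by (intro regularized_factor.intro) (simp_all add: linear_A1 A1_mem)
  interpret P2: regularized_factor ?G ?G2 h1 h2 "A2 h1 h2 N1 N2" k \<sigma> \<tau>
    using h kG \<sigma>0 \<open>\<tau> > 0\<close> 
    by (intro regularized_factor.intro) (simp_all add: linear_A2 A2_mem)
  let ?ip = "grid_inner ?G h1 h2"
  have C_eq: "C y = P1.Cp y + P2.Cp y" for y by (simp add: C Cop_def plus_fun_def)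
  have C_mem: "C y \<in> H" for y
    unfolding C_eq H by (intro grid_space_closed P1.Cpart_mem P2.Cpart_mem)
  have C_add: "C (y + z) = C y + C z" for y z
    by (simp add: C_eq P1.Cpart_add P2.Cpart_add)
  have C_scale: "C (scale_fun a y) = scale_fun a (C y)" for a y
    unfolding C_eq P1.Cpart_scale P2.Cpart_scale by (simp add: scale_fun_def fun_eq_iff algebra_simps)
  have C_sym: "ip (C y) z = ip y (C z)" if "y \<in> H" "z \<in> H" for y z
    using that by (simp add: C_eq ip H grid_inner_linear P1.Cpart_self_adjoint P2.Cpart_self_adjoint)
  have C_pos: "ip (C y) y > 0" if y: "y \<in> H" "y \<noteq> 0" for y
  proof -
    \<comment> \<open>The first direction supplies strict positivity; the second need only be
      nonnegative.\<close>
    have "A1 h1 h2 N1 N2 y \<noteq> 0" using A1_eq_0_imp_eq_0[of y] y h \<open>N1 \<ge> 1\<close> H by blast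
    then show ?thesis using P1.Cpart_pos[of y] P2.Cpart_nonneg[of y] y
      by (simp add: C_eq ip H grid_inner_linear)
  qed
  have PC: "pos_def_operator_on H scale_fun ip C"
    unfolding pos_def_operator_on_def using C_mem C_add C_scale C_sym C_pos by blast
  have R_eq: "R y x = \<nu> * c x * y x - \<tau>\<^sup>2 / 4 * C y x" for y x by (simp add: R Rop_def C)
  have R_eq': "R y = (\<lambda>x. \<nu> * c x * y x) - scale_fun (\<tau>\<^sup>2 / 4) (C y)" for y
    by (simp add: fun_eq_iff R_eq scale_fun_def)
  have PR: "pos_def_operator_on H scale_fun ip R"
    unfolding pos_def_operator_on_def
  proof (intro conjI ballI allI impI)
    fix y z and a :: real
    assume y: "y \<in> H"
    show "R y \<in> H" using y C_mem[of y] by (simp add: H grid_space_def R_eq)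
    show "R (y + z) = R y + R z" by (simp add: fun_eq_iff R_eq C_add algebra_simps)
    show "R (scale_fun a y) = scale_fun a (R y)"
      by (simp add: fun_eq_iff R_eq C_scale) (simp add: R_eq scale_fun_def algebra_simps)
  next
    fix y z assume yz: "y \<in> H" "z \<in> H"
    have "?ip (\<lambda>x. \<nu> * c x * y x) z = ?ip y (\<lambda>x. \<nu> * c x * z x)"
      by (simp add: grid_inner_def algebra_simps)
    then show "ip (R y) z = ip y (R z)"
      using C_sym[OF yz] by (simp add: R_eq' ip grid_inner_minus grid_inner_linear)
  next
    fix y assume y: "y \<in> H" "y \<noteq> 0"
    have "?ip (\<lambda>x. \<nu> * c x * y x) y \<ge> \<nu> * c0 * ?ip y y"
    proof -
      have "0 \<le> ?ip (\<lambda>x. (\<nu> * c x - \<nu> * c0) * y x) y"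
        using cG \<open>\<nu> > 0\<close> by (intro grid_inner_weighted_nonneg h) simp
      then show ?thesis
        by (simp add: grid_inner_def sum_distrib_left algebra_simps sum_subtractf)
    qed
    \<comment> \<open>Each of the two directions contributes less than the squared norm of
      \<open>y\<close>, whatever the step sizes.\<close>
    moreover have "\<sigma> * (\<tau>\<^sup>2 * ?ip (C y) y) < 2 * ?ip y y"
      using P1.Cpart_less[of y] P2.Cpart_less[of y] y
      by (simp add: C_eq H grid_inner_linear algebra_simps)
    \<comment> \<open>The condition on \<sigma> enters here: doubled, this bound turns the factor 2
      into \<open>4 * \<nu> * c0 * \<sigma>\<close>, which matches the quarter in \<open>R\<close>
      once \<sigma> is cancelled.\<close>
    moreover have "?ip y y \<le> 2 * (\<nu> * c0 * \<sigma>) * ?ip y y"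
      using \<sigma> grid_inner_self_nonneg[OF h, of ?G y] mult_right_mono[of 1 "2 * (\<nu> * c0 * \<sigma>)" "?ip y y"] by simp
    ultimately have "\<sigma> * (\<tau>\<^sup>2 * ?ip (C y) y) < \<sigma> * (4 * (\<nu> * c0 * ?ip y y))"
      by (simp add: algebra_simps)
    then have "\<tau>\<^sup>2 * ?ip (C y) y < 4 * (\<nu> * c0 * ?ip y y)" using \<sigma>0 by simp
    then show "ip (R y) y > 0"
      using \<open>?ip (\<lambda>x. \<nu> * c x * y x) y \<ge> \<nu> * c0 * ?ip y y\<close>
      by (simp add: R_eq' ip grid_inner_minus grid_inner_linear)
  qed
  have PQ: "pos_def_quadratic_form_on (H \<times> H) scale_pair Q"
    unfolding Q H ip using PR PC \<open>\<tau> > 0\<close> by (intro pos_def_quadratic_form_energy) (simp_all add: H ip)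
  have "0 \<in> H \<times> H" "\<And>x y. x \<in> H \<times> H \<Longrightarrow> y \<in> H \<times> H \<Longrightarrow> x + y \<in> H \<times> H"
    "\<And>a x. x \<in> H \<times> H \<Longrightarrow> scale_pair a x \<in> H \<times> H"
    by (auto simp: H zero_prod_def scale_pair_def intro!: grid_space_closed)
  note nrm = pos_def_quadratic_form_sqrt_norm[OF PQ this]
  have "\<exists>p. is_norm_on (H \<times> H) scale_pair p \<and> (\<forall>z\<in>H \<times> H. Q z = (p z)\<^sup>2)"
    using nrm by (intro exI[of _ "\<lambda>z. sqrt (Q z)"]) simp
  moreover have "S (n + 1) \<le> S n + \<tau> / 2 * ip (\<lambda>x. inverse (c x) * \<phi> n x) (\<phi> n)"
    if n: "1 \<le> n" "n \<le> N - 1" for n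
  proof -
    \<comment> \<open>The range of \<open>n\<close> keeps both energies, and all three levels of
      \<open>u\<close>, between 0 and \<open>N\<close>.\<close>
    have SS: "S (n + 1) = Q (u (n + 1), u n)" "S n = Q (u n, u (n - 1))"
      using n S[of "n + 1"] S[of n] by auto
    show ?thesis
      unfolding SS Q ip
    proof (rule energy_step[OF h \<open>\<tau> > 0\<close>])
      show "0 < c x" if "x \<in> ?G" for x using cG[OF that] \<open>c0 > 0\<close> by simp
      show "u (n + 1) \<in> grid_space ?G" "u n \<in> grid_space ?G" "u (n - 1) \<in> grid_space ?G"
        using n u[of "n + 1"] u[of n] u[of "n - 1"] by (auto simp: H)
    show "R y x = \<nu> * c x * y x - \<tau>\<^sup>2 / 4 * C y x" for y x by (rule R_eq)
    qed (use PR PC scheme[OF n] in \<open>simp_all add: H ip\<close>)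
  qed
  ultimately show ?thesis using PR PQ by blast
qed

end
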